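(* For every integer $n\ge 0$, the following four expressions are equal: \begin{align*} \text{(i)}\quad & \frac{4}{n+1}\sum_{0\le k<\ell<\lceil n/2\rceil}\frac{\binom nk}{\binom n\ell}+[n\text{ even}]\,\frac{1}{n+1}\left(\frac{2^n}{\binom{n}{n/2}}-1\right)+1,\\ \text{(ii)}\quad & \frac{2}{\lfloor n/2\rfloor+1}\sum_{0\le k<\ell\le\lfloor n/2\rfloor}\frac{\binom{2\lfloor n/2\rfloor+1}{k}}{\binom{2\lfloor n/2\rfloor+1}{\ell}}+1,\\ \text{(iii)}\quad & \frac{1}{n+1}\sum_{m=0}^{\lfloor n/2\rfloor}\sum_{\ell=m}^{n-m}\frac{\binom{2m}{m}\binom{n-2m}{\ell-m}}{\binom n\ell},\\ \text{(iv)}\quad & H^{\mathrm{odd}}_{n+1}. \end{align*}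
   Context: $[\mathit{expr}]$ is $1$ if $\mathit{expr}$ is true and $0$ otherwise (the term with $[n\text{ even}]$ is $0$ for odd $n$). $H^{\mathrm{odd}}_n=\sum_{1\le m\le n,\ m\text{ odd}}\frac1m$. The double sums in (i) and (ii) run over pairs of integers $(k,\ell)$. *)

theory Defs
  imports Complex_Main
begin

definition H_odd :: "nat \<Rightarrow> real" where
  "H_odd n = (\<Sum>m | 1 \<le> m \<and> m \<le> n \<and> odd m. 1 / real m)"

end

(*
  Write P(n,l) for the sum of (n choose k) over k < l, and V n L for the sum of
  P(n,l) / ((n + 1) (n choose l)) over l < L.  Pascal's rule for P and the reciprocal rule
    1 / ((n+1) (n choose l)) = (1 / (n+1 choose l) + 1 / (n+1 choose l+1)) / (n+2)
  give the recurrence 2 V n L = V (n+1) L + V (n+1) (L+1) - L / ((n+1)(n+2)).  Alternating between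
  even and odd n near the middle of the rows, it yields both (i) and (ii).  In (iii) the same
  reciprocal rule shows that the inner sum divided by n + 1 does not depend on n, so the m-th
  term is 1 / (2m + 1).
*)

theory Submission
  imports Defs
begin

section \<open>Odd harmonic sums, reciprocals of binomial coefficients, and the sum in (iii)\<close>

lemma H_odd_Suc: "H_odd (Suc n) = (\<Sum>m\<le>n div 2. 1 / real (2 * m + 1))"
proof -
  have "{m. 1 \<le> m \<and> m \<le> Suc n \<and> odd m} = (\<lambda>m. 2 * m + 1) ` {..n div 2}"
    by (auto simp: image_iff elim!: oddE)
  moreover have "inj_on (\<lambda>m::nat. 2 * m + 1) {..n div 2}"
    by (auto simp: inj_on_def)
  ultimately show ?thesis
    unfolding H_odd_def by (simp add: sum.reindex)
qed

text \<open>By the two absorption identities the reciprocals are \<open>(n + 1 - l)\<close> and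
  \<open>(l + 1)\<close> over the common denominator \<open>(n + 1) * (n choose l)\<close>, and
  these numerators add up to \<open>n + 2\<close>.\<close>

lemma inverse_binomial_Suc:
  assumes "l \<le> n"
  shows "1 / real (Suc n choose l) + 1 / real (Suc n choose Suc l)
       = real (n + 2) / (real (n + 1) * real (n choose l))"
proof -
  have "real (Suc n - l) * real (Suc n choose l) = real (Suc n) * real (n choose l)"
    using binomial_absorb_comp[of "Suc n" l] by (metis diff_Suc_1 of_nat_mult)
  then have a: "(1 + real n - real l) * real (Suc n choose l) = (1 + real n) * real (n choose l)"
    using assms by (simp add: of_nat_diff del: binomial_Suc_Suc)
  have "real (Suc l) * real (Suc n choose Suc l) = real (Suc n) * real (n choose l)"
    using Suc_times_binomial_eq[of n l] by (metis mult.commute of_nat_mult)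
  then have b: "(1 + real l) * real (Suc n choose Suc l) = (1 + real n) * real (n choose l)"
    by (simp del: binomial_Suc_Suc)
  have pos: "real (n choose l) > 0" "real (Suc n choose l) > 0" "real (Suc n choose Suc l) > 0"
    using assms by (simp_all del: binomial_Suc_Suc)
  have "1 / real (Suc n choose l) = (1 + real n - real l) / ((1 + real n) * real (n choose l))"
    using a pos by (simp add: frac_eq_eq del: binomial_Suc_Suc)
  moreover have "1 / real (Suc n choose Suc l) = (1 + real l) / ((1 + real n) * real (n choose l))"
    using b pos by (simp add: frac_eq_eq del: binomial_Suc_Suc)
  ultimately show ?thesis
    by (simp add: add_divide_distrib[symmetric] add.commute del: binomial_Suc_Suc)
qed

text \<open>Pascal's rule in summed form: lowering the row from \<open>Suc N\<close> to
  \<open>N\<close> turns the weight \<open>g\<close> into sums of neighbours, the shape that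
  \<open>inverse_binomial_Suc\<close> collapses.\<close>

lemma sum_binomial_Suc:
  fixes g :: "nat \<Rightarrow> 'a::comm_semiring_1"
  shows "(\<Sum>j\<le>Suc N. of_nat (Suc N choose j) * g j)
       = (\<Sum>j\<le>N. of_nat (N choose j) * (g j + g (Suc j)))"
proof -
  have "(\<Sum>j\<le>N. of_nat (N choose j) * g j) = (\<Sum>j\<le>Suc N. of_nat (N choose j) * g j)"
    by (simp add: binomial_eq_0)
  also have "\<dots> = g 0 + (\<Sum>j\<le>N. of_nat (N choose Suc j) * g (Suc j))"
    by (subst sum.atMost_Suc_shift) simp
  finally show ?thesis
    by (subst sum.atMost_Suc_shift) (simp add: distrib_left distrib_right sum.distrib add_ac)
qed

text \<open>With \<open>m\<close> fixed, each step in \<open>N\<close> multiplies the sum by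
  \<open>(n + 2) / (n + 1)\<close>, where \<open>n = N + 2 * m\<close>. So the sum divided by
  \<open>n + 1\<close> keeps its value at \<open>N = 0\<close>; it is the Beta integral of
  \<open>(x * (1 - x)) ^ m\<close> over [0,1].\<close>

lemma sum_binomial_ratio:
  "(\<Sum>j\<le>N. real (N choose j) / real ((N + 2 * m) choose (j + m)))
     = real (N + 2 * m + 1) / (real (2 * m + 1) * real ((2 * m) choose m))"
proof (induction N)
  case 0
  then show ?case by simp
next
  case (Suc N)
  let ?n = "N + 2 * m"
  have "(\<Sum>j\<le>Suc N. real (Suc N choose j) / real ((Suc N + 2 * m) choose (j + m)))
      = (\<Sum>j\<le>N. real (N choose j) *
          (1 / real (Suc ?n choose (j + m)) + 1 / real (Suc ?n choose Suc (j + m))))"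
    using sum_binomial_Suc[of N "\<lambda>j. 1 / real (Suc ?n choose (j + m))"] by simp
  also have "\<dots> = (\<Sum>j\<le>N. real (?n + 2) / real (?n + 1) *
                       (real (N choose j) / real (?n choose (j + m))))"
    by (intro sum.cong refl, subst inverse_binomial_Suc) auto
  also have "\<dots> = real (?n + 2) / real (?n + 1) *
                  (real (?n + 1) / (real (2 * m + 1) * real ((2 * m) choose m)))"
    by (simp only: sum_distrib_left[symmetric] Suc.IH)
  also have "\<dots> = real (Suc N + 2 * m + 1) / (real (2 * m + 1) * real ((2 * m) choose m))"
    by (simp add: add_ac)
  finally show ?case .
qed

lemma sum_central_binomial_ratio:
  assumes "2 * m \<le> n"
  shows "(\<Sum>l = m..n - m. real ((2 * m) choose m) * real ((n - 2 * m) choose (l - m)) / real (n choose l))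
       = real (n + 1) / real (2 * m + 1)"
proof -
  obtain N where n: "n = N + 2 * m"
    using assms by (metis le_add_diff_inverse2)
  have "(\<Sum>l = m..n - m. real ((2 * m) choose m) * real ((n - 2 * m) choose (l - m)) / real (n choose l))
      = (\<Sum>l = 0 + m..N + m. real ((2 * m) choose m) * (real (N choose (l - m)) / real (n choose l)))"
    by (simp add: n add.commute)
  also have "\<dots> = real ((2 * m) choose m) * (\<Sum>j\<le>N. real (N choose j) / real (n choose (j + m)))"
    by (simp only: sum.shift_bounds_cl_nat_ivl sum_distrib_left[symmetric] add_diff_cancel_right'
                   atMost_atLeast0)
  also have "\<dots> = real (n + 1) / real (2 * m + 1)"
    unfolding n sum_binomial_ratio by simp
  finally show ?thesis .
qed

section \<open>Weighted partial row sums and their recurrence\<close>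

definition binomial_psum :: "nat \<Rightarrow> nat \<Rightarrow> real" where
  "binomial_psum n l = (\<Sum>k<l. real (n choose k))"

text \<open>Dividing by \<open>n + 1\<close> absorbs the row-dependent factor of the reciprocal
  rule, so that the \<open>V\<close> terms in \<open>V_rec\<close> have constant
  coefficients.\<close>

definition V :: "nat \<Rightarrow> nat \<Rightarrow> real" where
  "V n L = (\<Sum>l<L. binomial_psum n l / real (n choose l)) / real (n + 1)"

lemma V_Suc: "V n (Suc L) = V n L + binomial_psum n L / real (n choose L) / real (n + 1)"
  by (simp add: V_def add_divide_distrib)

lemma binomial_psum_Suc: "binomial_psum n (Suc l) = binomial_psum n l + real (n choose l)"
  by (simp add: binomial_psum_def)

lemma binomial_psum_Suc_Suc:
  "binomial_psum (Suc n) (Suc l) = 2 * binomial_psum n l + real (n choose l)"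
  by (induction l) (simp_all add: binomial_psum_def)

text \<open>Induction on \<open>L\<close> compares increments: row \<open>n\<close> contributes one
  term, row \<open>n + 1\<close> two neighbouring ones, which the reciprocal rule merges.\<close>

lemma V_rec:
  assumes "L \<le> n + 1"
  shows "2 * V n L = V (Suc n) L + V (Suc n) (Suc L) - real L / (real (n + 1) * real (n + 2))"
  using assms
proof (induction L)
  case 0
  then show ?case by (simp add: V_def binomial_psum_def)
next
  case (Suc L)
  let ?c = "real (n choose L)" and ?d = "real (Suc n choose L)" and ?e = "real (Suc n choose Suc L)"
  let ?P = "binomial_psum n L" and ?Q = "binomial_psum (Suc n)"
  have le: "L \<le> n" using Suc.prems by simp
  then have pos: "?c > 0" "?d > 0" "?e > 0"
    by (simp_all del: binomial_Suc_Suc)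
  have Q: "?Q (Suc L) = 2 * ?P + ?c"
    by (rule binomial_psum_Suc_Suc)
  have Q': "?Q L = 2 * ?P + ?c - ?d"
    using Q binomial_psum_Suc[of "Suc n" L] by linarith
  \<comment> \<open>The two numerators differ only by \<open>?d\<close>, which contributes the -1;
    this is the source of the correction term in the recurrence.\<close>
  have "?Q L / ?d + ?Q (Suc L) / ?e = (2 * ?P + ?c) * (1 / ?d + 1 / ?e) - 1"
    unfolding Q Q' using pos by (simp add: field_simps del: binomial_Suc_Suc)
  also have "\<dots> = (2 * ?P + ?c) * (real (n + 2) / (real (n + 1) * ?c)) - 1"
    by (simp only: inverse_binomial_Suc[OF le])
  finally have "(?Q L / ?d + ?Q (Suc L) / ?e) / real (n + 2)
      = ((2 * ?P + ?c) * (real (n + 2) / (real (n + 1) * ?c)) - 1) / real (n + 2)"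
    by (rule arg_cong)
  also have "\<dots> = 2 * (?P / ?c / real (n + 1)) + 1 / (real (n + 1) * real (n + 2))"
  proof -
    have "((2 * x + c) * ((N + 1) / (N * c)) - 1) / (N + 1) = 2 * (x / c / N) + 1 / (N * (N + 1))"
      if "c > 0" "N > 0" for x c N :: real
      using that by (simp add: divide_simps) algebra
    from this[OF pos(1), of "real (n + 1)" ?P] show ?thesis
      by (simp add: add_ac)
  qed
  finally have "(?Q L / ?d + ?Q (Suc L) / ?e) / real (n + 2)
      = 2 * (?P / ?c / real (n + 1)) + 1 / (real (n + 1) * real (n + 2))" .
  moreover have "real (Suc L) / (real (n + 1) * real (n + 2))
      = real L / (real (n + 1) * real (n + 2)) + 1 / (real (n + 1) * real (n + 2))"
    by (simp add: add_divide_distrib del: of_nat_add)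
  ultimately show ?case
    using Suc.IH Suc.prems V_Suc[of n L] V_Suc[of "Suc n" L] V_Suc[of "Suc n" "Suc L"]
    by (simp add: add_divide_distrib del: binomial_Suc_Suc)
qed

text \<open>Adding \<open>V_rec\<close> in row \<open>2 * p\<close> for \<open>L = p\<close> and
  \<open>L = p + 1\<close> gives \<open>V\<close> at \<open>p\<close>, twice at
  \<open>p + 1\<close>, and at \<open>p + 2\<close> in the next row. The two middle coefficients of
  that odd row agree, so the second difference is exactly \<open>1 / (2 * p + 2)\<close>, and the
  two corrections cancel it.\<close>

lemma V_even_imp_odd:
  "4 * V (2 * p + 1) (p + 1) = 2 * (V (2 * p) p + V (2 * p) (p + 1))"
proof -
  let ?n = "2 * p + 1"
  let ?c = "real (?n choose p)"
  have sym: "?n choose (p + 1) = ?n choose p"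
    using binomial_symmetric[of p ?n] by simp
  have pos: "?c > 0" by simp
  have "V ?n (p + 2) - V ?n (p + 1) - (V ?n (p + 1) - V ?n p)
      = (binomial_psum ?n (Suc p) - binomial_psum ?n p) / ?c / real (?n + 1)"
    using V_Suc[of ?n p] V_Suc[of ?n "p + 1"] sym by (simp add: diff_divide_distrib)
  also have "\<dots> = 1 / real (?n + 1)"
    unfolding binomial_psum_Suc using pos by simp
  finally have diff: "V ?n (p + 2) + V ?n p = 2 * V ?n (p + 1) + 1 / real (2 * p + 2)"
    by simp
  have "real p / (real (2 * p + 1) * real (2 * p + 2))
      + real (p + 1) / (real (2 * p + 1) * real (2 * p + 2)) = 1 / real (2 * p + 2)"
  proof -
    have eq: "real p + real (p + 1) = real (2 * p + 1)" by simp
    show ?thesis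
      by (subst add_divide_distrib[symmetric], subst eq)
        (simp del: of_nat_add of_nat_mult of_nat_Suc)
  qed
  then show ?thesis
    using V_rec[of p "2 * p"] V_rec[of "p + 1" "2 * p"] diff by simp
qed

text \<open>Passing from row \<open>2 * p\<close> to row \<open>2 * p + 1\<close> changes nothing.
  Passing on to row \<open>2 * p + 2\<close> by \<open>V_rec\<close> at \<open>L = p + 1\<close>
  adds, after doubling, the next term \<open>1 / (2 * p + 3)\<close>.\<close>

lemma V_even: "1 + 2 * (V (2 * p) p + V (2 * p) (p + 1)) = (\<Sum>m\<le>p. 1 / real (2 * m + 1))"
proof (induction p)
  case 0
  then show ?case by (simp add: V_def binomial_psum_def)
next
  case (Suc p)
  have "4 * V (2 * p + 1) (p + 1) = 2 * (V (2 * Suc p) (Suc p) + V (2 * Suc p) (Suc p + 1))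
      - 1 / real (2 * Suc p + 1)"
  proof -
    have eqs: "real (2 * p + 1 + 1) = real (p + 1) * 2" "2 * p + 1 + 2 = 2 * Suc p + 1"
      by simp_all
    have "real (p + 1) / (real (2 * p + 1 + 1) * real (2 * p + 1 + 2)) = 1 / real (2 * Suc p + 1) / 2"
      unfolding eqs mult.assoc by (simp del: of_nat_add of_nat_mult of_nat_Suc)
    then have "2 * V (2 * p + 1) (p + 1)
        = V (2 * Suc p) (Suc p) + V (2 * Suc p) (Suc p + 1) - 1 / real (2 * Suc p + 1) / 2"
      using V_rec[of "p + 1" "2 * p + 1"] by (simp del: of_nat_add of_nat_mult of_nat_Suc)
    moreover have "4 * v = 2 * (a + b) - c" if "2 * v = a + b - c / 2" for a b c v :: real
      using that by simp
    ultimately show ?thesis by blast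
  qed
  then show ?case
    using Suc.IH V_even_imp_odd[of p] by simp
qed

lemma V_odd: "1 + 4 * V (2 * p + 1) (p + 1) = (\<Sum>m\<le>p. 1 / real (2 * m + 1))"
  using V_even V_even_imp_odd by metis

section \<open>Translating (i) and (ii) into values of \<open>V\<close>\<close>

lemma sum_pairs_less:
  "(\<Sum>(k, l) \<in> {(k, l). 0 \<le> k \<and> k < l \<and> l < L}. real (n choose k) / real (n choose l))
     = real (n + 1) * V n L"
proof -
  have "(\<Sum>(k, l) \<in> {(k, l). 0 \<le> k \<and> k < l \<and> l < L}. real (n choose k) / real (n choose l))
      = (\<Sum>(l, k) \<in> (SIGMA l:{..<L}. {..<l}). real (n choose k) / real (n choose l))"
    by (rule sum.reindex_bij_witness[of _ prod.swap prod.swap]) auto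
  also have "\<dots> = (\<Sum>l<L. \<Sum>k<l. real (n choose k) / real (n choose l))"
    by (rule sum.Sigma[symmetric]) auto
  finally show ?thesis
    by (simp add: V_def binomial_psum_def sum_divide_distrib[symmetric])
qed

text \<open>The lower half of row \<open>2 * p + 1\<close> sums to \<open>4 ^ p\<close>; Pascal's
  rule carries this back to row \<open>2 * p\<close>.\<close>

lemma central_binomial_psum: "2 * binomial_psum (2 * p) p = 2 ^ (2 * p) - real ((2 * p) choose p)"
proof -
  have "binomial_psum (2 * p + 1) (p + 1) = real (\<Sum>k\<le>p. (2 * p + 1) choose k)"
    unfolding binomial_psum_def by (simp add: lessThan_Suc_atMost)
  then show ?thesis
    using binomial_psum_Suc_Suc[of "2 * p" p] unfolding binomial_r_part_sum by simp
qed

theorem mainTheorem6: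
  fixes n :: nat
  shows "4 / real (n + 1) *
             (\<Sum>(k, l) \<in> {(k, l). 0 \<le> k \<and> k < l \<and> l < nat \<lceil>real n / 2\<rceil>}.
                real (n choose k) / real (n choose l))
           + of_bool (even n) * (1 / real (n + 1) * (2 ^ n / real (n choose (n div 2)) - 1))
           + 1
         = H_odd (n + 1)
       \<and> 2 / real (n div 2 + 1) *
             (\<Sum>(k, l) \<in> {(k, l). 0 \<le> k \<and> k < l \<and> l \<le> n div 2}.
                real ((2 * (n div 2) + 1) choose k) / real ((2 * (n div 2) + 1) choose l))
           + 1
         = H_odd (n + 1)
       \<and> 1 / real (n + 1) *
             (\<Sum>m = 0..n div 2. \<Sum>l = m..n - m.
                real ((2 * m) choose m) * real ((n - 2 * m) choose (l - m)) / real (n choose l))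
         = H_odd (n + 1)"
proof -
  define p where "p = n div 2"
  have H: "H_odd (n + 1) = (\<Sum>m\<le>p. 1 / real (2 * m + 1))"
    by (simp add: H_odd_Suc p_def)
  have i: "4 / real (n + 1) *
             (\<Sum>(k, l) \<in> {(k, l). 0 \<le> k \<and> k < l \<and> l < nat \<lceil>real n / 2\<rceil>}.
                real (n choose k) / real (n choose l))
           + of_bool (even n) * (1 / real (n + 1) * (2 ^ n / real (n choose (n div 2)) - 1))
           + 1 = H_odd (n + 1)"
  proof (cases "even n")
    case True
    then have n: "n = 2 * p" by (simp add: p_def)
    have "2 ^ n / real (n choose p) - 1 = 2 * (binomial_psum n p / real (n choose p))"
      using central_binomial_psum[of p] by (simp add: n diff_divide_distrib)
    \<comment> \<open>The even-case correction in (i) is twice the term \<open>l = p\<close> of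
      \<open>V\<close>, which turns \<open>4 * V n p\<close> into the symmetric
      \<open>2 * (V n p + V n (p + 1))\<close> of \<open>V_even\<close>.\<close>
    then have "1 / real (n + 1) * (2 ^ n / real (n choose p) - 1) = 2 * (V n (p + 1) - V n p)"
      using V_Suc[of n p] by simp
    moreover have "nat \<lceil>real n / 2\<rceil> = p" by (simp add: n)
    ultimately show ?thesis
      using V_even[of p] True unfolding H sum_pairs_less p_def[symmetric] by (simp add: n)
  next
    case False
    then have n: "n = 2 * p + 1" unfolding p_def by presburger
    have "\<lceil>real n / 2\<rceil> = int (p + 1)"
      by (rule ceiling_unique) (simp_all add: n)
    then have "nat \<lceil>real n / 2\<rceil> = p + 1" by simp
    then show ?thesis
      using V_odd[of p] False unfolding H sum_pairs_less by (simp add: n)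
  qed
  have ii: "2 / real (n div 2 + 1) *
             (\<Sum>(k, l) \<in> {(k, l). 0 \<le> k \<and> k < l \<and> l \<le> n div 2}.
                real ((2 * (n div 2) + 1) choose k) / real ((2 * (n div 2) + 1) choose l))
           + 1 = H_odd (n + 1)"
  proof -
    \<comment> \<open>Since \<open>2 * p + 2\<close> is twice \<open>p + 1\<close>, (ii) is one plus
      the quantity in \<open>V_odd\<close>, whatever the parity of \<open>n\<close>.\<close>
    have "2 / real (p + 1) * (real (2 * p + 1 + 1) * V (2 * p + 1) (Suc p)) = 4 * V (2 * p + 1) (p + 1)"
      by (simp add: field_simps)
    then show ?thesis
      using V_odd[of p]
      unfolding H p_def[symmetric] less_Suc_eq_le[of _ p, symmetric] sum_pairs_less by simp
  qed
  have iii: "1 / real (n + 1) *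
             (\<Sum>m = 0..n div 2. \<Sum>l = m..n - m.
                real ((2 * m) choose m) * real ((n - 2 * m) choose (l - m)) / real (n choose l))
         = H_odd (n + 1)"
  proof -
    have eq: "(\<Sum>m = 0..n div 2. \<Sum>l = m..n - m.
              real ((2 * m) choose m) * real ((n - 2 * m) choose (l - m)) / real (n choose l))
        = (\<Sum>m\<le>p. real (n + 1) * (1 / real (2 * m + 1)))"
      unfolding p_def atMost_atLeast0
      by (intro sum.cong refl, subst sum_central_binomial_ratio) auto
    show ?thesis
      unfolding H eq sum_distrib_left[symmetric] by simp
  qed
  from i ii iii show ?thesis by blast
qed

end
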